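(* Let $\mu>0$, $\epsilon>0$ and $0<p\le 1$. Let $F(x)=\Pr\{\zeta\le x\}$ be the distribution function of a nonnegative random variable $\zeta$ with expectation $1/\mu$, and suppose $$\sup_{x,y\ge 0}|F_y(x)-F(x)|<\epsilon,\qquad F_y(x)=\Pr\{\zeta\le x+y\mid\zeta>y\}.$$ Let $\chi$ be a random variable with distribution function $B(x)=pF(x)+(1-p)(1-\mathrm{e}^{-\mu x})$, $x\ge 0$, with $B(0)=0$, and let $B_y(x)=\Pr\{\chi\le x+y\mid\chi>y\}$. Then $$\sup_{x\ge 0,\,y\ge 0}|B_y(x)-B(x)|<5\epsilon .$$
   Context: The conditional distributions $F_y$ and $B_y$ are considered for those $y\ge 0$ for which the conditioning event ($\zeta>y$, respectively $\chi>y$) has positive probability. *)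

theory Defs
  imports "HOL-Probability.Probability"
begin

definition residual_cdf :: "'a measure \<Rightarrow> ('a \<Rightarrow> real) \<Rightarrow> real \<Rightarrow> real \<Rightarrow> real" where
  "residual_cdf M Z y x = \<P>(\<omega> in M. Z \<omega> \<le> x + y \<bar> Z \<omega> > y)"

text \<open>The conditioning event must have positive probability: elsewhere \<^const>\<open>cond_prob\<close>
  is a quotient by zero and takes the value \<open>0\<close>.\<close>

definition residual_domain :: "'a measure \<Rightarrow> ('a \<Rightarrow> real) \<Rightarrow> (real \<times> real) set" where
  "residual_domain M Z = {(x, y). 0 \<le> x \<and> 0 \<le> y \<and> \<P>(\<omega> in M. Z \<omega> > y) > 0}"

end

theory Submission
  imports Defs
begin

text \<open>
  Write \<open>G = 1 - F\<close>, \<open>E x = exp (- \<mu> * x)\<close> and \<open>H = 1 - B = p * G + (1 - p) * E\<close> for the three tails,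
  and \<open>s\<close> for the supremum that the hypothesis bounds by \<open>\<epsilon>\<close>. The hypothesis says that \<open>G\<close> is almost
  multiplicative: \<open>\<bar>G (x + y) - G x * G y\<bar> \<le> s * G y\<close>. Among tails with positive mean, only
  exponentials are exactly multiplicative,
  and the first half of the argument makes this quantitative: \<open>\<bar>G - E\<bar> \<le> 2 * s\<close> on the half-line
  (\<open>near_memoryless_imp_near_exponential\<close>). For this, integrate the inequality over \<open>y \<ge> 0\<close>. As the
  integral of \<open>G\<close> is the mean \<open>m = 1 / \<mu>\<close>, the integrated tail \<open>T x = \<integral>\<^sub>x\<^sup>\<infinity> G\<close> satisfies
  \<open>\<bar>T - m * G\<bar> \<le> s * m\<close>, an approximate form of the equation \<open>T = - m * T'\<close> that characterizes
  \<open>m * E\<close> among functions with value \<open>m\<close> at \<open>0\<close>. A barrier argument gives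
  \<open>\<bar>T - m * E\<bar> \<le> s * m\<close>, and the two bounds together give the claim.

  The second half is the identity
  \<open>H (x + y) - H x * H y = p * (G (x + y) - G x * G y) + p * (1 - p) * (G x - E x) * (G y - E y)\<close>.
  If \<open>H y > 0\<close>, then relative to \<open>H y\<close> the first term is at most \<open>s\<close>. In the second, \<open>p * (1 - p) * \<bar>G y - E y\<bar> \<le> H y\<close>
  holds whatever \<open>y\<close> is, so that the term is at most \<open>\<bar>G x - E x\<bar> * H y \<le> 2 * s * H y\<close>. Hence the residual
  distributions of the mixture differ from \<open>B\<close> by at most \<open>3 * s\<close>, which is less than \<open>5 * \<epsilon>\<close>.
\<close>

section \<open>Tails and residual distributions\<close>

lemma (in prob_space) tail_eq_prob_greater:
  fixes Z :: "'a \<Rightarrow> real"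
  assumes [measurable]: "Z \<in> borel_measurable M"
  shows "1 - cdf (distr M borel Z) t = \<P>(\<omega> in M. Z \<omega> > t)"
proof -
  have "cdf (distr M borel Z) t = \<P>(\<omega> in M. Z \<omega> \<le> t)"
    unfolding cdf_def by (subst measure_distr) (auto intro!: arg_cong[where f = prob])
  moreover have "\<P>(\<omega> in M. \<not> Z \<omega> \<le> t) = 1 - \<P>(\<omega> in M. Z \<omega> \<le> t)"
    by (rule prob_neg) simp
  ultimately show ?thesis
    by (simp add: not_le)
qed

lemma (in prob_space) residual_cdf_eq_tail_ratio:
  fixes Z :: "'a \<Rightarrow> real"
  assumes [measurable]: "Z \<in> borel_measurable M"
    and "\<And>t. G t = 1 - cdf (distr M borel Z) t"
    and "x \<ge> 0" "G y > 0"
  shows "residual_cdf M Z y x = 1 - G (x + y) / G y"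
proof -
  have G: "G t = \<P>(\<omega> in M. Z \<omega> > t)" for t
    using assms(2) tail_eq_prob_greater[OF assms(1)] by simp
  have "{\<omega> \<in> space M. Z \<omega> > y} = {\<omega> \<in> space M. Z \<omega> \<le> x + y \<and> Z \<omega> > y} \<union> {\<omega> \<in> space M. Z \<omega> > x + y}"
    using \<open>x \<ge> 0\<close> by auto
  then have "G y = \<P>(\<omega> in M. Z \<omega> \<le> x + y \<and> Z \<omega> > y) + G (x + y)"
    unfolding G using \<open>x \<ge> 0\<close> by (simp only:) (rule finite_measure_Union, auto)
  then have "residual_cdf M Z y x = (G y - G (x + y)) / G y"
    unfolding residual_cdf_def cond_prob_def G[of y, symmetric] by simp
  then show ?thesis
    using \<open>G y > 0\<close> by (simp add: field_simps)
qed

text \<open>A nonnegative number is the length of the interval below it, so \<open>Z \<omega> = \<integral>\<^sub>0\<^sup>\<infinity> 1[t < Z \<omega>] dt\<close>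
  almost surely; taking expectations and exchanging the two integrals produces the integral of
  the tail.\<close>

lemma (in prob_space) integral_tail_eq_expectation:
  fixes Z :: "'a \<Rightarrow> real"
  assumes Z: "integrable M Z" and nonneg: "AE \<omega> in M. 0 \<le> Z \<omega>"
    and G: "\<And>t. G t = 1 - cdf (distr M borel Z) t"
  shows "set_integrable lborel {0..} G" "(LBINT t:{0..}. G t) = expectation Z"
proof -
  have [measurable]: "Z \<in> borel_measurable M"
    using Z by auto
  interpret P: pair_sigma_finite lborel M ..
  have G': "G t = prob {\<omega> \<in> space M. Z \<omega> > t}" for t
    using G tail_eq_prob_greater[of Z t] by simp
  have [measurable]: "G \<in> borel_measurable borel"
    unfolding G' by measurable
  have "(\<integral>\<^sup>+ t. ennreal (indicator {0..} t * G t) \<partial>lborel)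
      = (\<integral>\<^sup>+ t. (\<integral>\<^sup>+ \<omega>. indicator {0..} t * indicator {\<omega>. Z \<omega> > t} \<omega> \<partial>M) \<partial>lborel)"
  proof (intro nn_integral_cong)
    fix t :: real
    have "(\<integral>\<^sup>+ \<omega>. indicator {0..} t * indicator {\<omega>. Z \<omega> > t} \<omega> \<partial>M)
        = (\<integral>\<^sup>+ \<omega>. indicator {0..} t * indicator {\<omega> \<in> space M. Z \<omega> > t} \<omega> \<partial>M)"
      by (intro nn_integral_cong) (auto simp: indicator_def)
    also have "\<dots> = indicator {0..} t * emeasure M {\<omega> \<in> space M. Z \<omega> > t}"
      by (subst nn_integral_cmult_indicator) auto
    finally show "ennreal (indicator {0..} t * G t)
        = (\<integral>\<^sup>+ \<omega>. indicator {0..} t * indicator {\<omega>. Z \<omega> > t} \<omega> \<partial>M)"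
      by (simp add: G' emeasure_eq_measure indicator_def)
  qed
  also have "\<dots> = (\<integral>\<^sup>+ \<omega>. (\<integral>\<^sup>+ t. indicator {0..} t * indicator {\<omega>. Z \<omega> > t} \<omega> \<partial>lborel) \<partial>M)"
    by (rule P.Fubini'[symmetric]) (simp add: indicator_def, measurable)
  also have "\<dots> = (\<integral>\<^sup>+ \<omega>. ennreal (Z \<omega>) \<partial>M)"
  proof (intro nn_integral_cong_AE, use nonneg in eventually_elim)
    fix \<omega> assume "0 \<le> Z \<omega>"
    have "(\<integral>\<^sup>+ t. indicator {0..} t * indicator {\<omega>. Z \<omega> > t} \<omega> \<partial>lborel)
        = (\<integral>\<^sup>+ t. indicator {0..<Z \<omega>} t \<partial>lborel)"
      by (intro nn_integral_cong) (auto simp: indicator_def)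
    also have "\<dots> = ennreal (Z \<omega>)"
      using \<open>0 \<le> Z \<omega>\<close> by simp
    finally show "(\<integral>\<^sup>+ t. indicator {0..} t * indicator {\<omega>. Z \<omega> > t} \<omega> \<partial>lborel) = ennreal (Z \<omega>)" .
  qed
  also have "\<dots> = ennreal (expectation Z)"
    by (rule nn_integral_eq_integral[OF Z nonneg])
  finally have *: "(\<integral>\<^sup>+ t. ennreal (indicator {0..} t * G t) \<partial>lborel) = ennreal (expectation Z)" .
  have "has_bochner_integral lborel (\<lambda>t. indicator {0..} t * G t) (expectation Z)"
    by (rule has_bochner_integral_nn_integral[OF _ _ _ *])
       (auto simp: G' integral_nonneg_AE[OF nonneg])
  then show "set_integrable lborel {0..} G" "(LBINT t:{0..}. G t) = expectation Z"
    by (auto simp: set_integrable_def set_lebesgue_integral_def has_bochner_integral_iff)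
qed

text \<open>Multiplying the bound on the residual distribution by \<open>1 - F y\<close> removes the conditioning.
  In this form it also covers those \<open>y\<close> that the supremum leaves out, because the tail then
  vanishes from \<open>y\<close> on.\<close>

lemma (in prob_space) near_memoryless_of_residual_SUP:
  fixes Z :: "'a \<Rightarrow> real"
  assumes [measurable]: "Z \<in> borel_measurable M"
    and F: "F = cdf (distr M borel Z)"
    and s: "s = (SUP (x, y) \<in> residual_domain M Z. \<bar>residual_cdf M Z y x - F x\<bar>)"
    and "0 \<le> x" "0 \<le> y"
  shows "\<bar>(1 - F (x + y)) - (1 - F x) * (1 - F y)\<bar> \<le> s * (1 - F y)"
proof -
  have G: "1 - F t = \<P>(\<omega> in M. Z \<omega> > t)" for t
    unfolding F by (rule tail_eq_prob_greater) simp
  have F01: "0 \<le> F t" "F t \<le> 1" for t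
    using G[of t] prob_le_1 by (auto simp: F cdf_def, metis diff_ge_0_iff_ge measure_nonneg)
  show ?thesis
  proof (cases "1 - F y > 0")
    case True
    \<comment> \<open>A supremum of reals bounds the values only if the set of values is bounded.\<close>
    have "bdd_above ((\<lambda>(x, y). \<bar>residual_cdf M Z y x - F x\<bar>) ` residual_domain M Z)"
    proof (rule bdd_aboveI[of _ 1], safe)
      fix u v
      have "0 \<le> residual_cdf M Z v u" "residual_cdf M Z v u \<le> 1"
        unfolding residual_cdf_def cond_prob_def
        by (auto intro!: divide_le_eq_1[THEN iffD2] finite_measure_mono simp: zero_less_measure_iff)
      then show "\<bar>residual_cdf M Z v u - F u\<bar> \<le> 1"
        using F01[of u] by linarith
    qed
    moreover have "(x, y) \<in> residual_domain M Z"
      using assms(4,5) True[unfolded G] by (simp add: residual_domain_def)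
    ultimately have "\<bar>residual_cdf M Z y x - F x\<bar> \<le> s"
      unfolding s by (rule cSUP_upper2) auto
    moreover have "residual_cdf M Z y x = 1 - (1 - F (x + y)) / (1 - F y)"
      by (rule residual_cdf_eq_tail_ratio) (use assms True in auto)
    ultimately have "\<bar>(1 - F (x + y)) / (1 - F y) - (1 - F x)\<bar> * (1 - F y) \<le> s * (1 - F y)"
      using True by (intro mult_right_mono) auto
    also have "\<bar>(1 - F (x + y)) / (1 - F y) - (1 - F x)\<bar> * (1 - F y)
        = \<bar>((1 - F (x + y)) / (1 - F y) - (1 - F x)) * (1 - F y)\<bar>"
      using True by (simp add: abs_mult)
    also have "((1 - F (x + y)) / (1 - F y) - (1 - F x)) * (1 - F y)
        = (1 - F (x + y)) - (1 - F x) * (1 - F y)"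
      using True by (subst left_diff_distrib) simp
    finally show ?thesis .
  next
    case False
    have "1 - F (x + y) \<le> 1 - F y"
      unfolding G using \<open>0 \<le> x\<close> by (intro finite_measure_mono) auto
    with False F01[of y] F01[of "x + y"] show ?thesis
      by simp
  qed
qed

section \<open>Stability of the memoryless property\<close>

text \<open>If \<open>D' = - g\<close> and \<open>g \<ge> 0\<close> wherever \<open>D > c\<close>, then \<open>D\<close> cannot increase while it is above the barrier \<open>c\<close>, so it never gets
  above it from below. The derivative is replaced by its integrated form because, in the application,
  \<open>g\<close> is only as regular as a distribution function. The proof follows \<open>D\<close> from the last point
  at which it is at most \<open>c\<close>.\<close>

lemma barrier_le:
  fixes D g :: "real \<Rightarrow> real"
  assumes "a \<le> b" and cont: "continuous_on {a..b} D" and "D a \<le> c"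
    and int: "\<And>u. u \<in> {a..b} \<Longrightarrow> (g has_integral (D u - D b)) {u..b}"
    and above: "\<And>u. u \<in> {a..b} \<Longrightarrow> c < D u \<Longrightarrow> 0 \<le> g u"
  shows "D b \<le> c"
proof (rule ccontr)
  assume "\<not> D b \<le> c"
  define S where "S = {u \<in> {a..b}. D u \<le> c}"
  have "closed S"
    unfolding S_def using cont
    by (intro continuous_on_closed_Collect_le) (auto intro!: continuous_intros)
  moreover have "S \<noteq> {}" "bdd_above S"
    using \<open>a \<le> b\<close> \<open>D a \<le> c\<close> by (auto simp: S_def intro!: bdd_aboveI[of _ b])
  ultimately have S: "Sup S \<in> S"
    by (simp add: closed_contains_Sup)
  \<comment> \<open>The sign of \<open>g\<close> is known only to the right of \<open>Sup S\<close>, so its value at that point is changed.\<close>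
  have "((\<lambda>u. if u = Sup S then 0 else g u) has_integral (D (Sup S) - D b)) {Sup S..b}"
    by (rule has_integral_spike_finite[OF _ _ int, of "{Sup S}"]) (use S in \<open>auto simp: S_def\<close>)
  then have "0 \<le> D (Sup S) - D b"
  proof (rule has_integral_nonneg)
    fix u assume u: "u \<in> {Sup S..b}"
    have "u \<notin> S" if "u \<noteq> Sup S"
      using u that cSup_upper[OF _ \<open>bdd_above S\<close>, of u] by auto
    then show "0 \<le> (if u = Sup S then 0 else g u)"
      using u S above[of u] by (auto simp: S_def)
  qed
  then show False
    using S \<open>\<not> D b \<le> c\<close> by (simp add: S_def)
qed

text \<open>With \<open>D = T - m * E\<close> and \<open>g = G - E\<close>, where \<open>T\<close> is the integrated tail of \<open>G\<close> and \<open>E\<close> the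
  exponential, \<open>D\<close> has derivative \<open>- g\<close> in the integrated sense, and integrating the hypothesis gives
  \<open>\<bar>D - m * g\<bar> \<le> s * m\<close>. Thus \<open>g\<close> has the sign of \<open>D\<close> as soon as \<open>\<bar>D\<bar> > s * m\<close>, which pushes \<open>D\<close>
  back, and since \<open>D 0 = 0\<close> the barriers \<open>s * m\<close> and \<open>- s * m\<close> are never crossed.\<close>

lemma near_memoryless_imp_near_exponential:
  fixes G :: "real \<Rightarrow> real"
  assumes mono: "antimono G" and "m > 0"
    and int: "set_integrable lborel {0..} G" and m: "(LBINT t:{0..}. G t) = m"
    and near: "\<And>x y. 0 \<le> x \<Longrightarrow> 0 \<le> y \<Longrightarrow> \<bar>G (x + y) - G x * G y\<bar> \<le> s * G y"
    and "0 \<le> x"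
  shows "\<bar>G x - exp (- x / m)\<bar> \<le> 2 * s"
proof -
  \<comment> \<open>For \<open>u \<ge> 0\<close> this is the integral of \<open>G\<close> over \<open>{u..}\<close>, written so that it is visibly continuous in \<open>u\<close>.\<close>
  define T where "T u = m - integral {0..u} G" for u
  define D where "D u = T u - m * exp (- u / m)" for u
  define g where "g u = G u - exp (- u / m)" for u
  have G_int: "G integrable_on {u..v}" for u v
  proof -
    have "(\<lambda>t. - G t) integrable_on {u..v}"
      using mono by (intro integrable_on_mono_on) (auto simp: mono_on_def antimono_def)
    then show ?thesis
      by (simp add: integrable_neg_iff)
  qed
  have T_near: "\<bar>T u - m * G u\<bar> \<le> s * m" if "0 \<le> u" for u
  proof -
    have "set_integrable lborel {u..} G"
      using \<open>0 \<le> u\<close> by (intro set_integrable_subset[OF int]) auto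
    then have "integrable lborel (\<lambda>t. indicator {u..} (u + 1 * t) * G (u + 1 * t))"
      unfolding set_integrable_def by (intro lborel_integrable_real_affine) auto
    then have shift_int: "set_integrable lborel {0..} (\<lambda>t. G (u + t))"
      unfolding set_integrable_def by (simp add: indicator_def)
    have "(LBINT t:{u..}. G t) = (LBINT t:{0..}. G (u + t))"
      unfolding set_lebesgue_integral_def
      by (subst lborel_integral_real_affine[of 1 _ u]) (auto simp: indicator_def)
    moreover have "m = (LBINT t:{0..<u}. G t) + (LBINT t:{u..}. G t)"
      using \<open>0 \<le> u\<close> unfolding m[symmetric]
      by (subst set_integral_Un[symmetric])
         (auto intro: set_integrable_subset[OF int] simp: ivl_disj_un)
    moreover have "(LBINT t:{0..<u}. G t) = integral {0..<u} G"
      by (intro set_borel_integral_eq_integral set_integrable_subset[OF int]) auto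
    moreover have "integral {0..<u} G = integral {0..u} G"
      by (intro integral_spike_set; rule negligible_subset[of "{u}"]) auto
    ultimately have T: "T u = (LBINT t:{0..}. G (u + t))"
      by (simp add: T_def)
    have bounds: "(G u - s) * G t \<le> G (u + t)" "G (u + t) \<le> (G u + s) * G t" if "t \<in> {0..}" for t
      using near[OF \<open>0 \<le> u\<close>, of t] that
      unfolding left_diff_distrib distrib_right abs_le_iff by auto
    have "T u \<le> (LBINT t:{0..}. (G u + s) * G t)"
      unfolding T by (intro set_integral_mono shift_int bounds set_integrable_mult_right int)
    moreover have "(LBINT t:{0..}. (G u - s) * G t) \<le> T u"
      unfolding T by (intro set_integral_mono shift_int bounds set_integrable_mult_right int)
    ultimately show ?thesis
      unfolding set_integral_mult_right m by (simp add: algebra_simps abs_le_iff)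
  qed
  have D_int: "(g has_integral (D u - D x)) {u..x}" if "u \<in> {0..x}" for u
  proof -
    have "(G has_integral (T u - T x)) {u..x}"
    proof -
      have "integral {0..u} G + integral {u..x} G = integral {0..x} G"
        using that by (intro Henstock_Kurzweil_Integration.integral_combine G_int) auto
      then have "T u - T x = integral {u..x} G"
        by (simp add: T_def)
      then show ?thesis
        using integrable_integral[OF G_int[of u x]] by simp
    qed
    moreover have "((\<lambda>t. exp (- t / m)) has_integral
        (- m * exp (- x / m) - - m * exp (- u / m))) {u..x}"
      using that \<open>m > 0\<close>
      by (intro fundamental_theorem_of_calculus)
         (auto intro!: derivative_eq_intros simp flip: has_real_derivative_iff_has_vector_derivative)
    ultimately have "((\<lambda>t. G t - exp (- t / m)) has_integral
        (T u - T x) - (- m * exp (- x / m) - - m * exp (- u / m))) {u..x}"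
      by (rule has_integral_diff)
    then show ?thesis
      unfolding g_def[abs_def] by (simp add: D_def algebra_simps)
  qed
  have D_cont: "continuous_on {0..x} D"
    unfolding D_def T_def using \<open>m > 0\<close>
    by (intro continuous_intros indefinite_integral_continuous_1 G_int) auto
  have D0: "D 0 = 0"
    by (simp add: D_def T_def)
  have D_near: "\<bar>D u - m * g u\<bar> \<le> s * m" if "0 \<le> u" for u
    using T_near[OF that] by (simp add: D_def g_def algebra_simps)
  have "0 \<le> s * m"
    using T_near[of 0] by linarith
  have g_nonneg: "0 \<le> g u" if "0 \<le> u" "s * m < D u" for u
  proof -
    have "0 \<le> m * g u"
      using D_near[OF \<open>0 \<le> u\<close>] that by linarith
    then show ?thesis
      using \<open>m > 0\<close> by (simp add: zero_le_mult_iff)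
  qed
  have g_nonpos: "g u \<le> 0" if "0 \<le> u" "s * m < - D u" for u
  proof -
    have "m * g u \<le> 0"
      using D_near[OF \<open>0 \<le> u\<close>] that by linarith
    then show ?thesis
      using \<open>m > 0\<close> by (simp add: mult_le_0_iff)
  qed
  have "D x \<le> s * m"
    using \<open>0 \<le> x\<close> \<open>0 \<le> s * m\<close> D0 by (intro barrier_le[OF _ D_cont _ D_int] g_nonneg) auto
  moreover have "- D x \<le> s * m"
  proof (rule barrier_le[of 0 x "\<lambda>u. - D u" _ "\<lambda>u. - g u"])
    show "((\<lambda>u. - g u) has_integral (- D u - - D x)) {u..x}" if "u \<in> {0..x}" for u
      using has_integral_neg[OF D_int[OF that]] by simp
  qed (use \<open>0 \<le> x\<close> \<open>0 \<le> s * m\<close> D0 D_cont g_nonpos in \<open>auto intro!: continuous_intros\<close>)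
  ultimately have "\<bar>m * g x\<bar> \<le> m * (2 * s)"
    using D_near[OF \<open>0 \<le> x\<close>] by (simp add: algebra_simps abs_le_iff)
  then show ?thesis
    using \<open>m > 0\<close> by (simp add: g_def abs_mult)
qed

section \<open>Mixtures with an exponential distribution\<close>

text \<open>Read \<open>gx\<close>, \<open>gy\<close>, \<open>gxy\<close> as values of a tail at \<open>x\<close>, \<open>y\<close>, \<open>x + y\<close>, and \<open>ex\<close>, \<open>ey\<close> as values of
  the exponential tail, whose value at \<open>x + y\<close> is exactly \<open>ex * ey\<close>. The defect of the mixture consists
  of \<open>p\<close> times the defect of the first component and the covariance term
  \<open>p * (1 - p) * (gx - ex) * (gy - ey)\<close>. To stay relative to the mixture at \<open>y\<close>, even where
  it is small, only the factor at \<open>x\<close> is bounded by \<open>2 * s\<close>; the factor at \<open>y\<close> is absorbed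
  by the mixture itself.\<close>

lemma mixture_near_memoryless:
  fixes p s gx gy gxy ex ey :: real
  assumes p: "0 \<le> p" "p \<le> 1" and nonneg: "0 \<le> gy" "0 \<le> ey" "0 \<le> s"
    and memoryless: "\<bar>gxy - gx * gy\<bar> \<le> s * gy" and near: "\<bar>gx - ex\<bar> \<le> 2 * s"
  shows "\<bar>(p * gxy + (1 - p) * (ex * ey)) - (p * gx + (1 - p) * ex) * (p * gy + (1 - p) * ey)\<bar>
       \<le> 3 * s * (p * gy + (1 - p) * ey)"
proof -
  let ?hy = "p * gy + (1 - p) * ey"
  have split: "(p * gxy + (1 - p) * (ex * ey)) - (p * gx + (1 - p) * ex) * ?hy
      = p * (gxy - gx * gy) + (gx - ex) * (p * (1 - p) * (gy - ey))"
    by algebra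
  have "\<bar>p * (gxy - gx * gy)\<bar> \<le> p * (s * gy)"
    using memoryless p by (simp add: abs_mult mult_left_mono)
  also have "\<dots> \<le> s * ?hy"
  proof -
    have "0 \<le> s * ((1 - p) * ey)"
      using p nonneg by simp
    then show ?thesis
      by (simp add: algebra_simps)
  qed
  finally have 1: "\<bar>p * (gxy - gx * gy)\<bar> \<le> s * ?hy" .
  have "p * (1 - p) * gy \<le> p * gy" "p * (1 - p) * ey \<le> (1 - p) * ey"
       "0 \<le> p * (1 - p) * gy" "0 \<le> p * (1 - p) * ey" "0 \<le> p * gy" "0 \<le> (1 - p) * ey"
    using p nonneg by (auto intro!: mult_right_mono simp: mult_left_le mult_left_le_one_le)
  then have "\<bar>p * (1 - p) * (gy - ey)\<bar> \<le> ?hy"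
    unfolding right_diff_distrib by linarith
  then have 2: "\<bar>(gx - ex) * (p * (1 - p) * (gy - ey))\<bar> \<le> 2 * s * ?hy"
    unfolding abs_mult[of "gx - ex"] using near nonneg by (intro mult_mono) auto
  show ?thesis
    unfolding split using 1 2 by linarith
qed

theorem lemma2p1:
  fixes \<mu> \<epsilon> p :: real
    and M :: "'a measure" and Z :: "'a \<Rightarrow> real"
    and N :: "'b measure" and X :: "'b \<Rightarrow> real"
    and F B :: "real \<Rightarrow> real"
  assumes "\<mu> > 0" and "\<epsilon> > 0" and "0 < p" and "p \<le> 1"
    and "prob_space M" and "Z \<in> borel_measurable M"
    and "AE \<omega> in M. 0 \<le> Z \<omega>"
    and "integrable M Z" and "prob_space.expectation M Z = 1 / \<mu>"
    and "F = cdf (distr M borel Z)"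
    and "(SUP (x, y) \<in> residual_domain M Z. \<bar>residual_cdf M Z y x - F x\<bar>) < \<epsilon>"
    and "prob_space N" and "X \<in> borel_measurable N"
    and "B = cdf (distr N borel X)"
    and "\<And>x. x \<ge> 0 \<Longrightarrow> B x = p * F x + (1 - p) * (1 - exp (- \<mu> * x))"
    and "B 0 = 0"
  shows "(SUP (x, y) \<in> residual_domain N X. \<bar>residual_cdf N X y x - B x\<bar>) < 5 * \<epsilon>"
proof -
  interpret M: prob_space M by fact
  interpret N: prob_space N by fact
  define G where "G t = 1 - F t" for t
  define E where "E t = exp (- \<mu> * t)" for t
  define H where "H t = 1 - B t" for t
  define s where "s = (SUP (x, y) \<in> residual_domain M Z. \<bar>residual_cdf M Z y x - F x\<bar>)"
  have near: "\<bar>G (x + y) - G x * G y\<bar> \<le> s * G y" if "0 \<le> x" "0 \<le> y" for x y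
    unfolding G_def
    by (rule M.near_memoryless_of_residual_SUP[OF _ _ s_def that]) (use assms in auto)
  have G_prob: "G t = \<P>(\<omega> in M. Z \<omega> > t)" for t
    unfolding G_def using assms M.tail_eq_prob_greater by simp
  have H_prob: "H t = \<P>(\<omega> in N. X \<omega> > t)" for t
    unfolding H_def using assms N.tail_eq_prob_greater by simp
  have [measurable]: "Z \<in> borel_measurable M" by fact
  have "antimono G"
    unfolding G_prob by (intro antimonoI M.finite_measure_mono) auto
  have H: "H t = p * G t + (1 - p) * E t" if "0 \<le> t" for t
    using assms(15)[OF that] by (simp add: H_def G_def E_def algebra_simps)
  have "G 0 = 1"
    using assms(15)[of 0] assms(3,16) by (simp add: G_def)
  then have "0 \<le> s"
    using near[of 0 0] by simp
  have GE: "\<bar>G x - E x\<bar> \<le> 2 * s" if "0 \<le> x" for x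
  proof -
    have "set_integrable lborel {0..} G" "(LBINT t:{0..}. G t) = 1 / \<mu>"
      using M.integral_tail_eq_expectation[OF assms(8,7), of G] assms(9,10) by (simp_all add: G_def)
    then have "\<bar>G x - exp (- x / (1 / \<mu>))\<bar> \<le> 2 * s"
      by (rule near_memoryless_imp_near_exponential[OF \<open>antimono G\<close> _ _ _ near that, rotated])
         (use \<open>\<mu> > 0\<close> in auto)
    then show ?thesis
      by (simp add: E_def mult.commute)
  qed
  have "\<bar>residual_cdf N X y x - B x\<bar> \<le> 3 * s" if "(x, y) \<in> residual_domain N X" for x y
  proof -
    have xy: "0 \<le> x" "0 \<le> y" "0 < H y"
      using that by (auto simp: residual_domain_def H_prob)
    have "E (x + y) = E x * E y"
      by (simp add: E_def distrib_left flip: exp_add)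
    then have "\<bar>H (x + y) - H x * H y\<bar> \<le> 3 * s * H y"
      using mixture_near_memoryless[OF _ \<open>p \<le> 1\<close> _ _ \<open>0 \<le> s\<close> near[OF xy(1,2)] GE[OF xy(1)], of "E y"]
        \<open>0 < p\<close> G_prob[of y] E_def[of y] H[of x] H[of y] H[of "x + y"] xy by simp
    then have "\<bar>H (x + y) - H x * H y\<bar> / H y \<le> 3 * s"
      using xy by (simp add: field_simps)
    moreover have "\<bar>H (x + y) - H x * H y\<bar> / H y = \<bar>H (x + y) / H y - H x\<bar>"
    proof -
      have "H (x + y) / H y - H x = (H (x + y) - H x * H y) / H y"
        using xy by (simp add: diff_divide_distrib)
      then show ?thesis
        using xy by simp
    qed
    moreover have "residual_cdf N X y x = 1 - H (x + y) / H y"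
      by (rule N.residual_cdf_eq_tail_ratio) (use assms xy in \<open>auto simp: H_def\<close>)
    ultimately show ?thesis
      by (simp add: H_def)
  qed
  moreover have "(0, 0) \<in> residual_domain N X"
    using H_prob[of 0] \<open>B 0 = 0\<close> by (simp add: residual_domain_def H_def flip: H_prob)
  ultimately have "(SUP (x, y) \<in> residual_domain N X. \<bar>residual_cdf N X y x - B x\<bar>) \<le> 3 * s"
    by (intro cSUP_least) auto
  also have "3 * s < 5 * \<epsilon>"
    using assms(11) \<open>0 \<le> s\<close> \<open>\<epsilon> > 0\<close> unfolding s_def[symmetric] by linarith
  finally show ?thesis .
qed

end
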